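(* There is a constant $K < 12.65$ such that for every $n \ge 2$ and every $\epsilon \ge 0$, every $\epsilon$-modular set function $f: 2^{[n]} \to \mathbb{R}$ is $K\epsilon$-linear. Consequently the strong Kalton constant satisfies $K_s < 12.65$.
   Context: A set function on the ground set $U=[n]=\{1,\dots,n\}$ is a map $f:2^U\to\mathbb{R}$. It is $\epsilon$-modular if $|f(S)+f(T)-f(S\cup T)-f(S\cap T)|\le\epsilon$ for all $S,T\subseteq U$. It is linear if there are constants $c_0,\dots,c_n$ with $f(S)=c_0+\sum_{i\in S}c_i$ for all $S$. It is $\Delta$-linear if there is a linear set function $\ell$ with $|f(S)-\ell(S)|\le\Delta$ for all $S$. The strong Kalton constant $K_s$ is the smallest constant such that for every $n$ and every $\epsilon\ge0$, every $\epsilon$-modular set function over $[n]$ is $K_s\epsilon$-linear. *)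

theory Defs
  imports Complex_Main
begin

text \<open>Set functions over \<open>[n] = {1..n}\<close> are modelled as functions of type \<open>nat set \<Rightarrow> real\<close>, and only
  their values on subsets of \<open>{1..n}\<close> are ever referred to.\<close>

definition modular_within :: "nat \<Rightarrow> real \<Rightarrow> (nat set \<Rightarrow> real) \<Rightarrow> bool" where
  "modular_within n \<epsilon> f \<longleftrightarrow>
    (\<forall>S T. S \<subseteq> {1..n} \<longrightarrow> T \<subseteq> {1..n} \<longrightarrow> \<bar>f S + f T - f (S \<union> T) - f (S \<inter> T)\<bar> \<le> \<epsilon>)"

definition linear_set_function :: "nat \<Rightarrow> (nat set \<Rightarrow> real) \<Rightarrow> bool" where
  "linear_set_function n f \<longleftrightarrow>
    (\<exists>c :: nat \<Rightarrow> real. \<forall>S. S \<subseteq> {1..n} \<longrightarrow> f S = c 0 + (\<Sum>i\<in>S. c i))"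

definition linear_within :: "nat \<Rightarrow> real \<Rightarrow> (nat set \<Rightarrow> real) \<Rightarrow> bool" where
  "linear_within n \<Delta> f \<longleftrightarrow>
    (\<exists>l. linear_set_function n l \<and> (\<forall>S. S \<subseteq> {1..n} \<longrightarrow> \<bar>f S - l S\<bar> \<le> \<Delta>))"

definition Kalton_bound :: "real \<Rightarrow> bool" where
  "Kalton_bound K \<longleftrightarrow>
    (\<forall>n \<epsilon> f. 0 \<le> \<epsilon> \<longrightarrow> modular_within n \<epsilon> f \<longrightarrow> linear_within n (K * \<epsilon>) f)"

text \<open>The description operator \<open>LEAST\<close> is meaningful here: as soon as some bound exists, a least one
  does; see \<open>strong_Kalton_is_least\<close> below.\<close>

definition strong_Kalton_constant :: real where
  "strong_Kalton_constant = (LEAST K. Kalton_bound K)"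

lemma Kalton_bound_nonneg:
  assumes "Kalton_bound K" shows "0 \<le> K"
proof -
  have "modular_within 0 1 (\<lambda>_. 0)" by (simp add: modular_within_def)
  then have "linear_within 0 (K * 1) (\<lambda>_. 0)"
    using assms unfolding Kalton_bound_def by (meson zero_le_one)
  then obtain l :: "nat set \<Rightarrow> real" where "\<bar>0 - l {}\<bar> \<le> K"
    unfolding linear_within_def by auto
  then show ?thesis by linarith
qed

lemma convergent_subsequence_coordinates:
  fixes x :: "nat \<Rightarrow> nat \<Rightarrow> real"
  assumes "finite I" and "\<And>i. i \<in> I \<Longrightarrow> Bseq (\<lambda>m. x m i)"
  shows "\<exists>r. strict_mono r \<and> (\<forall>i\<in>I. convergent (\<lambda>m. x (r m) i))"
  using assms
proof (induction I rule: finite_induct)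
  case empty
  show ?case using strict_mono_id by blast
next
  case (insert j I)
  then obtain r where r: "strict_mono r" "\<And>i. i \<in> I \<Longrightarrow> convergent (\<lambda>m. x (r m) i)"
    by auto
  obtain s :: "nat \<Rightarrow> nat" where s: "strict_mono s" "monoseq (\<lambda>m. x (r (s m)) j)"
    using seq_monosub[of "\<lambda>m. x (r m) j"] by auto
  have "Bseq (\<lambda>m. x (r (s m)) j)"
    using Bseq_subseq[of "\<lambda>m. x m j" "r \<circ> s"] insert.prems[of j] by (simp add: o_def)
  then have "convergent (\<lambda>m. x (r (s m)) j)"
    using s(2) by (rule Bseq_monoseq_convergent)
  moreover have "convergent (\<lambda>m. x (r (s m)) i)" if "i \<in> I" for i
    using convergent_subseq_convergent[OF r(2)[OF that] s(1)] by (simp add: o_def)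
  moreover have "strict_mono (r \<circ> s)" using r(1) s(1) by (rule strict_mono_o)
  ultimately show ?case by (intro exI[of _ "r \<circ> s"]) (auto simp: o_def)
qed

lemma linear_within_closed:
  assumes "\<And>\<delta>. 0 < \<delta> \<Longrightarrow> linear_within n (D + \<delta>) f"
  shows "linear_within n D f"
proof -
  define \<delta> :: "nat \<Rightarrow> real" where "\<delta> m = 1 / real (Suc m)" for m
  have \<delta>: "0 < \<delta> m" "\<delta> m \<le> 1" for m by (auto simp: \<delta>_def)
  have lim0: "\<delta> \<longlonglongrightarrow> 0"
    using LIMSEQ_inverse_real_of_nat by (simp add: \<delta>_def[abs_def] inverse_eq_divide)
  have "\<exists>c. \<forall>S. S \<subseteq> {1..n} \<longrightarrow> \<bar>f S - (c 0 + sum c S)\<bar> \<le> D + \<delta> m" for m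
  proof -
    obtain l c where "\<And>S. S \<subseteq> {1..n} \<Longrightarrow> l S = c 0 + sum c S"
      and "\<And>S. S \<subseteq> {1..n} \<Longrightarrow> \<bar>f S - l S\<bar> \<le> D + \<delta> m"
      using assms[OF \<delta>(1)[of m]] unfolding linear_within_def linear_set_function_def by blast
    then show ?thesis by (intro exI[of _ c]) auto
  qed
  then obtain c where c: "\<And>m S. S \<subseteq> {1..n} \<Longrightarrow> \<bar>f S - (c m 0 + sum (c m) S)\<bar> \<le> D + \<delta> m"
    using choice[of "\<lambda>m c. \<forall>S. S \<subseteq> {1..n} \<longrightarrow> \<bar>f S - (c 0 + sum c S)\<bar> \<le> D + \<delta> m"] by blast
  have c0: "\<bar>f {} - c m 0\<bar> \<le> D + 1" for m
    using c[of "{}" m] \<delta>(2)[of m] by simp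
  have ci: "\<bar>f {i} - (c m 0 + c m i)\<bar> \<le> D + 1" if "i \<in> {1..n}" for m i
    using c[of "{i}" m] \<delta>(2)[of m] that by simp
  have "Bseq (\<lambda>m. c m i)" if "i \<in> {0..n}" for i
  proof (rule BseqI')
    fix m
    show "norm (c m i) \<le> \<bar>f {}\<bar> + \<bar>f {i}\<bar> + 2 * (D + 1)"
    proof (cases "i = 0")
      case True then show ?thesis using c0[of m] by simp
    next
      case False then show ?thesis using c0[of m] ci[of i m] that by simp
    qed
  qed
  then obtain r where r: "strict_mono r" "\<And>i. i \<in> {0..n} \<Longrightarrow> convergent (\<lambda>m. c (r m) i)"
    using convergent_subsequence_coordinates[of "{0..n}" c] by auto
  define d where "d i = lim (\<lambda>m. c (r m) i)" for i
  have d: "(\<lambda>m. c (r m) i) \<longlonglongrightarrow> d i" if "i \<in> {0..n}" for i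
    using r(2)[OF that] by (simp add: convergent_LIMSEQ_iff d_def)
  have "\<bar>f S - (d 0 + sum d S)\<bar> \<le> D" if S: "S \<subseteq> {1..n}" for S
  proof -
    have "(\<lambda>m. \<bar>f S - (c (r m) 0 + (\<Sum>i\<in>S. c (r m) i))\<bar>) \<longlonglongrightarrow> \<bar>f S - (d 0 + sum d S)\<bar>"
      using S by (intro tendsto_intros d) auto
    moreover have "(\<lambda>m. D + \<delta> (r m)) \<longlonglongrightarrow> D + 0"
      using LIMSEQ_subseq_LIMSEQ[OF lim0 r(1)] by (intro tendsto_intros) (simp add: o_def)
    ultimately have "\<bar>f S - (d 0 + sum d S)\<bar> \<le> D + 0"
      by (rule LIMSEQ_le) (use c S in auto)
    then show ?thesis by simp
  qed
  then show ?thesis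
    unfolding linear_within_def linear_set_function_def
    by (intro exI[of _ "\<lambda>S. d 0 + sum d S"]) auto
qed

lemma strong_Kalton_is_least:
  assumes "Kalton_bound K"
  shows "Kalton_bound strong_Kalton_constant" and "strong_Kalton_constant \<le> K"
proof -
  define k where "k = Inf (Collect Kalton_bound)"
  have bdd: "bdd_below (Collect Kalton_bound)"
    using Kalton_bound_nonneg by (intro bdd_belowI[of _ 0]) auto
  have le: "k \<le> K'" if "Kalton_bound K'" for K'
    unfolding k_def using bdd that by (intro cInf_lower) auto
  have "Kalton_bound k"
    unfolding Kalton_bound_def
  proof (intro allI impI)
    fix n \<epsilon> f assume \<epsilon>: "0 \<le> \<epsilon>" and f: "modular_within n \<epsilon> f"
    show "linear_within n (k * \<epsilon>) f"
    proof (rule linear_within_closed)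
      fix \<delta> :: real assume \<delta>: "0 < \<delta>"
      have "k < k + \<delta> / (\<epsilon> + 1)" using \<epsilon> \<delta> by simp
      then obtain K' where K': "Kalton_bound K'" "K' < k + \<delta> / (\<epsilon> + 1)"
        using cInf_lessD[of "Collect Kalton_bound"] assms unfolding k_def by blast
      have "K' * \<epsilon> \<le> (k + \<delta> / (\<epsilon> + 1)) * \<epsilon>" using K'(2) \<epsilon> by (intro mult_right_mono) auto
      also have "\<dots> \<le> k * \<epsilon> + \<delta>" using \<epsilon> \<delta> by (simp add: field_simps)
      finally have "K' * \<epsilon> \<le> k * \<epsilon> + \<delta>" .
      moreover have "linear_within n (K' * \<epsilon>) f" using K'(1) \<epsilon> f unfolding Kalton_bound_def by blast
      ultimately show "linear_within n (k * \<epsilon> + \<delta>) f"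
        unfolding linear_within_def by (meson order_trans)
    qed
  qed
  then have "strong_Kalton_constant = k"
    unfolding strong_Kalton_constant_def using le by (rule Least_equality)
  then show "Kalton_bound strong_Kalton_constant" "strong_Kalton_constant \<le> K"
    using \<open>Kalton_bound k\<close> le assms by auto
qed

end

theory Submission
  imports Defs "HOL-Library.FuncSet" "HOL-Library.Disjoint_Sets"
begin

text \<open>Subtract a best linear approximation, so that \<open>\<bar>f\<bar> \<le> M\<close> with \<open>M\<close> minimal. By linear programming
  duality there are random sets \<open>P\<close> and \<open>Q\<close> in which every item has the same probability and with
  \<open>E f(P) - E f(Q)\<close> arbitrarily close to \<open>2 M\<close>. Passing to \<open>P - Q\<close> and \<open>Q - P\<close>, and then to intersections
  of two independent copies, makes every item occur with probability at most \<open>1/16\<close>, at a cost of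
  \<open>6 \<epsilon>\<close> in the gap \<open>2 M\<close>.

  Represent such a distribution by \<open>m\<close> sets. As in the argument of Kalton and Roberts, each of them is
  split into three parts, which are regrouped along a bipartite graph into \<open>m/4\<close> sets, each of value
  at most \<open>M\<close>. The graph has to match, for each item, the collection of at most \<open>m/16\<close> sets containing
  it. Since \<open>m\<close> may be taken huge compared with the number of items, this concerns only a few
  collections, and a random graph of degree three achieves it; an expander, which would handle all
  small collections simultaneously, is not necessary. Splitting and regrouping loses at most \<open>5 \<epsilon>\<close> per
  set, so \<open>2 M - 6 \<epsilon> \<le> M/2 + 10 \<epsilon>\<close>, that is \<open>M \<le> 32/3 \<epsilon>\<close>.\<close>

section \<open>Linear programming duality\<close>

text \<open>A pair \<open>(a, b)\<close> stands for the inequality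
  \<open>(\<Sum>i<n. a i * x i) \<le> b\<close>; the hull collects its consequences by nonnegative
  combination. The inductive form lets eliminations compose without tracking multipliers.\<close>

inductive_set conic_hull :: "((nat \<Rightarrow> real) \<times> real) set \<Rightarrow> ((nat \<Rightarrow> real) \<times> real) set"
  for C where
  base: "p \<in> C \<Longrightarrow> p \<in> conic_hull C"
| comb: "(a, b) \<in> conic_hull C \<Longrightarrow> (a', b') \<in> conic_hull C \<Longrightarrow> 0 \<le> s \<Longrightarrow> 0 \<le> t \<Longrightarrow>
    (\<lambda>i. s * a i + t * a' i, s * b + t * b') \<in> conic_hull C"

text \<open>Recovers the multipliers, which later become probabilities. They sit on indices rather
  than on pairs, since two indices may give the same inequality.\<close>

lemma conic_hull_weights:
  assumes "finite J" and "(a, b) \<in> conic_hull ((\<lambda>j. (A j, B j)) ` J)"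
  shows "\<exists>y. (\<forall>j\<in>J. 0 \<le> y j) \<and> (\<forall>i. a i = (\<Sum>j\<in>J. y j * A j i)) \<and> b = (\<Sum>j\<in>J. y j * B j)"
  using assms(2)
proof (induction a b rule: conic_hull.induct[split_format (complete)])
  case (base a b)
  then obtain j where j: "j \<in> J" "a = A j" "b = B j" by blast
  then show ?case
    using assms(1) by (intro exI[of _ "\<lambda>k. if k = j then 1 else 0"]) (simp add: if_distrib if_distribR cong: if_cong)
next
  case (comb a b a' b' s t)
  then obtain y y' where
    y: "\<And>j. j \<in> J \<Longrightarrow> 0 \<le> y j" "\<And>i. a i = (\<Sum>j\<in>J. y j * A j i)" "b = (\<Sum>j\<in>J. y j * B j)" and
    y': "\<And>j. j \<in> J \<Longrightarrow> 0 \<le> y' j" "\<And>i. a' i = (\<Sum>j\<in>J. y' j * A j i)" "b' = (\<Sum>j\<in>J. y' j * B j)"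
    by blast
  show ?case
    using comb.hyps(3,4) y y'
    by (intro exI[of _ "\<lambda>j. s * y j + t * y' j"])
      (auto simp: sum_distrib_left sum.distrib algebra_simps)
qed

lemma exists_between_finite:
  fixes L U :: "real set"
  assumes "finite L" "finite U" "\<And>l u. l \<in> L \<Longrightarrow> u \<in> U \<Longrightarrow> l \<le> u"
  shows "\<exists>y. (\<forall>l\<in>L. l \<le> y) \<and> (\<forall>u\<in>U. y \<le> u)"
proof (cases "L = {}")
  case True
  then show ?thesis using assms(2) by (intro exI[of _ "if U = {} then 0 else Min U"]) auto
next
  case False
  then show ?thesis using assms by (intro exI[of _ "Max L"]) auto
qed

text \<open>Farkas' lemma by induction on the number of variables: upper and lower bounds on the
  last variable are combined so that it cancels, and a solution of the reduced system extends
  because every lower bound then lies below every upper bound.\<close>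

lemma Fourier_Motzkin:
  assumes "finite C" and "\<nexists>x. \<forall>(a, b)\<in>C. (\<Sum>i<n. a i * x i) \<le> b"
  shows "\<exists>(a, b)\<in>conic_hull C. (\<forall>i<n. a i = 0) \<and> b < 0"
  using assms
proof (induction n arbitrary: C)
  case 0
  then obtain a b where "(a, b) \<in> C" "b < 0" by fastforce
  then show ?case using conic_hull.base by fastforce
next
  case (Suc n)
  define P where "P = {p \<in> C. 0 < fst p n}"
  define N where "N = {p \<in> C. fst p n < 0}"
  define Z where "Z = {p \<in> C. fst p n = 0}"
  \<comment> \<open>For \<open>p \<in> P\<close> and \<open>q \<in> N\<close> both multipliers are
    positive, and they cancel the coefficient at \<open>n\<close>.\<close>
  define e :: "((nat \<Rightarrow> real) \<times> real) \<times> ((nat \<Rightarrow> real) \<times> real) \<Rightarrow> (nat \<Rightarrow> real) \<times> real"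
    where "e = (\<lambda>(p, q). (\<lambda>i. (- fst q n) * fst p i + fst p n * fst q i, (- fst q n) * snd p + fst p n * snd q))"
  define D where "D = Z \<union> e ` (P \<times> N)"
  have finD: "finite D" and finP: "finite P" and finN: "finite N"
    using Suc.prems(1) by (auto simp: D_def Z_def P_def N_def)
  have D0: "fst p n = 0" if "p \<in> D" for p
    using that by (auto simp: D_def Z_def e_def)
  have DC: "p \<in> conic_hull C" if "p \<in> D" for p
  proof -
    have "e (p, q) \<in> conic_hull C" if "p \<in> P" "q \<in> N" for p q
      using that conic_hull.comb[of "fst p" "snd p" C "fst q" "snd q" "- fst q n" "fst p n"]
      by (auto simp: e_def P_def N_def intro: conic_hull.base)
    then show ?thesis using that by (auto simp: D_def Z_def intro: conic_hull.base)
  qed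
  \<comment> \<open>\<open>hull0\<close> turns a certificate for \<open>n\<close> variables into one
    for \<open>Suc n\<close>.\<close>
  have hull_sub: "(a, b) \<in> conic_hull C" and hull0: "a n = 0" if "(a, b) \<in> conic_hull D" for a b
  proof -
    from that have "(a, b) \<in> conic_hull C \<and> a n = 0"
    proof (induction a b rule: conic_hull.induct[split_format (complete)])
      case (base a b) then show ?case using DC[of "(a, b)"] D0[of "(a, b)"] by simp
    next
      case (comb a b a' b' s t) then show ?case by (auto intro: conic_hull.comb)
    qed
    then show "(a, b) \<in> conic_hull C" "a n = 0" by auto
  qed
  have "\<nexists>x. \<forall>(a, b)\<in>D. (\<Sum>i<n. a i * x i) \<le> b"
  proof
    assume "\<exists>x. \<forall>(a, b)\<in>D. (\<Sum>i<n. a i * x i) \<le> b"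
    then obtain x where x: "\<And>p. p \<in> D \<Longrightarrow> (\<Sum>i<n. fst p i * x i) \<le> snd p"
      by (force simp: case_prod_beta)
    define \<sigma> where "\<sigma> p = (\<Sum>i<n. fst p i * x i)" for p :: "(nat \<Rightarrow> real) \<times> real"
    \<comment> \<open>The bound that \<open>p\<close> puts on variable \<open>n\<close> once the
      others are fixed: an upper bound on \<open>P\<close>, a lower bound on
      \<open>N\<close>.\<close>
    define \<beta> where "\<beta> p = (snd p - \<sigma> p) / fst p n" for p
    have \<beta>_le: "\<beta> q \<le> \<beta> p" if pq: "p \<in> P" "q \<in> N" for p q
    proof -
      have "e (p, q) \<in> D" using pq by (auto simp: D_def)
      moreover have "(\<Sum>i<n. fst (e (p, q)) i * x i) = (- fst q n) * \<sigma> p + fst p n * \<sigma> q"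
        unfolding \<sigma>_def sum_distrib_left sum.distrib[symmetric]
        by (intro sum.cong) (auto simp: e_def algebra_simps)
      ultimately have "(- fst q n) * \<sigma> p + fst p n * \<sigma> q \<le> (- fst q n) * snd p + fst p n * snd q"
        using x[of "e (p, q)"] by (simp add: e_def)
      moreover have "0 < fst p n" "fst q n < 0" using pq by (auto simp: P_def N_def)
      ultimately show ?thesis unfolding \<beta>_def
        by (simp add: divide_simps) (simp add: algebra_simps)
    qed
    have "\<exists>y. (\<forall>l\<in>\<beta> ` N. l \<le> y) \<and> (\<forall>u\<in>\<beta> ` P. y \<le> u)"
    proof (rule exists_between_finite)
      fix l u assume "l \<in> \<beta> ` N" "u \<in> \<beta> ` P"
      then show "l \<le> u" using \<beta>_le by blast
    qed (use finP finN in simp_all)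
    then obtain y where "\<forall>l\<in>\<beta> ` N. l \<le> y" and "\<forall>u\<in>\<beta> ` P. y \<le> u"
      by (elim exE conjE)
    then have y: "\<And>q. q \<in> N \<Longrightarrow> \<beta> q \<le> y" "\<And>p. p \<in> P \<Longrightarrow> y \<le> \<beta> p"
      by (simp_all only: ball_simps)
    have "(\<Sum>i<Suc n. fst p i * (x(n := y)) i) \<le> snd p" if p: "p \<in> C" for p
    proof -
      have eq: "(\<Sum>i<Suc n. fst p i * (x(n := y)) i) = \<sigma> p + fst p n * y"
        by (simp add: \<sigma>_def)
      consider "p \<in> P" | "p \<in> N" | "p \<in> Z" using p by (force simp: P_def N_def Z_def)
      then show ?thesis
      proof cases
        case 1
        then have "0 < fst p n" by (simp add: P_def)
        then show ?thesis unfolding eq using y(2)[OF 1] by (simp add: \<beta>_def field_simps)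
      next
        case 2
        then have "fst p n < 0" by (simp add: N_def)
        then show ?thesis unfolding eq using y(1)[OF 2] by (simp add: \<beta>_def field_simps)
      next
        case 3
        then show ?thesis unfolding eq using x[of p] by (simp add: \<sigma>_def D_def Z_def)
      qed
    qed
    then have "\<forall>(a, b)\<in>C. (\<Sum>i<Suc n. a i * (x(n := y)) i) \<le> b"
      unfolding case_prod_beta by (rule ballI)
    then show False using Suc.prems(2) by (elim notE) (rule exI)
  qed
  from Suc.IH[OF finD this] obtain a b
    where "(a, b) \<in> conic_hull D" "\<forall>i<n. a i = 0" "b < 0" by blast
  then show ?case
    using hull_sub hull0 less_Suc_eq by (intro bexI[of _ "(a, b)"]) auto
qed

text \<open>The coefficients of an approximating linear function solve a system with two
  inequalities per set, one for each sign of the error. If it has no solution, Farkas' multipliers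
  for the two signs are the weights: the vanishing coefficient at \<open>0\<close> equates their
  masses, the one at \<open>i\<close> their marginals, and the negative right-hand side is the
  gap.\<close>

lemma not_linear_within_imp_dual_weights:
  assumes "\<not> linear_within n K f"
  obtains w w' :: "nat set \<Rightarrow> real"
  where "\<And>S. S \<subseteq> {1..n} \<Longrightarrow> 0 \<le> w S" "\<And>S. S \<subseteq> {1..n} \<Longrightarrow> 0 \<le> w' S"
    and "(\<Sum>S\<in>Pow {1..n}. w S) = 1" "(\<Sum>S\<in>Pow {1..n}. w' S) = 1"
    and "\<And>i. i \<in> {1..n} \<Longrightarrow>
      (\<Sum>S\<in>Pow {1..n}. w S * of_bool (i \<in> S)) = (\<Sum>S\<in>Pow {1..n}. w' S * of_bool (i \<in> S))"
    and "2 * K < (\<Sum>S\<in>Pow {1..n}. w S * f S) - (\<Sum>S\<in>Pow {1..n}. w' S * f S)"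
proof -
  let ?F = "Pow {1..n}"
  define \<chi> where "\<chi> S i = (if i = 0 then 1 else of_bool (i \<in> S) :: real)" for S :: "nat set" and i :: nat
  define A where "A = (\<lambda>(S, s) i. (if s then 1 else -1) * \<chi> S i)"
  define B where "B = (\<lambda>(S, s). K + (if s then 1 else -1) * f S)"
  define J where "J = ?F \<times> (UNIV :: bool set)"
  define C where "C = (\<lambda>j. (A j, B j)) ` J"
  have finJ: "finite J" by (simp add: J_def)
  have sum_chi: "(\<Sum>i<Suc n. \<chi> S i * x i) = x 0 + sum x S" if S: "S \<subseteq> {1..n}" for S x
  proof -
    have "(\<Sum>i<Suc n. \<chi> S i * x i) = x 0 + (\<Sum>i\<in>{1..n}. of_bool (i \<in> S) * x i)"
      by (simp add: sum.lessThan_Suc_shift \<chi>_def sum.atLeast1_atMost_eq del: sum.lessThan_Suc)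
    also have "(\<Sum>i\<in>{1..n}. of_bool (i \<in> S) * x i) = (\<Sum>i\<in>S. of_bool (i \<in> S) * x i)"
      using S by (intro sum.mono_neutral_right) auto
    finally show ?thesis by simp
  qed
  have "\<nexists>x. \<forall>(a, b)\<in>C. (\<Sum>i<Suc n. a i * x i) \<le> b"
  proof
    assume "\<exists>x. \<forall>(a, b)\<in>C. (\<Sum>i<Suc n. a i * x i) \<le> b"
    then obtain x where x: "\<And>j. j \<in> J \<Longrightarrow> (\<Sum>i<Suc n. A j i * x i) \<le> B j"
      by (auto simp: C_def)
    have "\<bar>f S - (x 0 + sum x S)\<bar> \<le> K" if S: "S \<subseteq> {1..n}" for S
    proof -
      have "x 0 + sum x S \<le> K + f S"
        using x[of "(S, True)"] S sum_chi[OF S, of x] by (simp add: J_def A_def B_def del: sum.lessThan_Suc)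
      moreover have "- (x 0 + sum x S) \<le> K - f S"
        using x[of "(S, False)"] S sum_chi[OF S, of x]
        by (simp add: J_def A_def B_def sum_negf del: sum.lessThan_Suc)
      ultimately show ?thesis by linarith
    qed
    then have "linear_within n K f"
      unfolding linear_within_def linear_set_function_def
      by (intro exI[of _ "\<lambda>S. x 0 + sum x S"]) auto
    then show False using assms by simp
  qed
  then obtain a b where ab: "(a, b) \<in> conic_hull C" "\<And>i. i < Suc n \<Longrightarrow> a i = 0" "b < 0"
    using Fourier_Motzkin[of C "Suc n"] finJ by (auto simp: C_def)
  obtain y where y: "\<And>j. j \<in> J \<Longrightarrow> 0 \<le> y j" "\<And>i. a i = (\<Sum>j\<in>J. y j * A j i)" "b = (\<Sum>j\<in>J. y j * B j)"
    using conic_hull_weights[OF finJ ab(1)[unfolded C_def]] by blast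
  have sumJ: "(\<Sum>j\<in>J. g j) = (\<Sum>S\<in>?F. g (S, True)) + (\<Sum>S\<in>?F. g (S, False))" for g :: "_ \<Rightarrow> real"
  proof -
    have "(\<Sum>j\<in>J. g j) = (\<Sum>S\<in>?F. \<Sum>s\<in>UNIV. g (S, s))"
      by (simp add: J_def sum.cartesian_product)
    then show ?thesis by (simp add: UNIV_bool sum.distrib add.commute)
  qed
  \<comment> \<open>The sign \<open>False\<close> belongs to the constraint
    \<open>f S - l S \<le> K\<close>, so \<open>p\<close> forms the positive side of the
    gap.\<close>
  define p where "p S = y (S, False)" for S
  define q where "q S = y (S, True)" for S
  have nonneg: "0 \<le> p S" "0 \<le> q S" if "S \<subseteq> {1..n}" for S
    using that y(1) by (auto simp: p_def q_def J_def)
  have marg: "(\<Sum>S\<in>?F. p S * \<chi> S i) = (\<Sum>S\<in>?F. q S * \<chi> S i)" if "i < Suc n" for i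
    using ab(2)[OF that] y(2)[of i] by (simp add: sumJ A_def p_def q_def sum_negf)
  define \<Lambda> where "\<Lambda> = (\<Sum>S\<in>?F. p S)"
  have \<Lambda>q: "(\<Sum>S\<in>?F. q S) = \<Lambda>"
    using marg[of 0] by (simp add: \<Lambda>_def \<chi>_def)
  have gap: "2 * K * \<Lambda> < (\<Sum>S\<in>?F. p S * f S) - (\<Sum>S\<in>?F. q S * f S)"
  proof -
    have "(\<Sum>S\<in>?F. q S * (K + f S)) = K * \<Lambda> + (\<Sum>S\<in>?F. q S * f S)"
      by (simp add: distrib_left sum.distrib \<Lambda>q[symmetric] sum_distrib_left mult.commute)
    moreover have "(\<Sum>S\<in>?F. p S * (K - f S)) = K * \<Lambda> - (\<Sum>S\<in>?F. p S * f S)"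
      by (simp add: right_diff_distrib sum_subtractf \<Lambda>_def sum_distrib_left mult.commute)
    ultimately have "b = (K * \<Lambda> + (\<Sum>S\<in>?F. q S * f S)) + (K * \<Lambda> - (\<Sum>S\<in>?F. p S * f S))"
      unfolding y(3) sumJ by (simp add: B_def p_def q_def)
    then show ?thesis using ab(3) by simp
  qed
  \<comment> \<open>With total mass 0 all weights would vanish and \<open>gap\<close> would read 0 <
    0.\<close>
  have "\<Lambda> \<noteq> 0"
  proof
    assume 0: "\<Lambda> = 0"
    have "p S = 0" if "S \<in> ?F" for S
      using 0 nonneg(1) that unfolding \<Lambda>_def by (subst (asm) sum_nonneg_eq_0_iff) auto
    moreover have "q S = 0" if "S \<in> ?F" for S
      using 0 nonneg(2) that unfolding \<Lambda>q[symmetric] by (subst (asm) sum_nonneg_eq_0_iff) auto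
    ultimately show False using gap 0 by simp
  qed
  moreover have "0 \<le> \<Lambda>" unfolding \<Lambda>_def using nonneg(1) by (intro sum_nonneg) auto
  ultimately have \<Lambda>: "0 < \<Lambda>" by simp
  show thesis
  proof
    fix i assume i: "i \<in> {1..n}"
    then show "(\<Sum>S\<in>?F. p S / \<Lambda> * of_bool (i \<in> S)) = (\<Sum>S\<in>?F. q S / \<Lambda> * of_bool (i \<in> S))"
      using marg[of i] by (simp add: \<chi>_def flip: sum_divide_distrib)
  next
    show "2 * K < (\<Sum>S\<in>?F. p S / \<Lambda> * f S) - (\<Sum>S\<in>?F. q S / \<Lambda> * f S)"
      using gap \<Lambda> by (simp add: field_simps flip: sum_divide_distrib)
  qed (use nonneg \<Lambda> \<Lambda>q in \<open>auto simp: \<Lambda>_def simp flip: sum_divide_distrib\<close>)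
qed

section \<open>Splitting and regrouping\<close>

text \<open>If a nonempty proper subset \<open>T\<close> has exactly \<open>card T\<close>
  neighbours, it is matched first and the rest outside those neighbours. Otherwise every nonempty
  proper subset has a neighbour to spare, so one vertex may take any of its neighbours.\<close>

theorem Hall_matching:
  assumes "finite S" and "\<And>v. v \<in> S \<Longrightarrow> finite (G v)"
    and "\<And>T. T \<subseteq> S \<Longrightarrow> card T \<le> card (\<Union>(G ` T))"
  shows "\<exists>\<phi>. inj_on \<phi> S \<and> (\<forall>v\<in>S. \<phi> v \<in> G v)"
  using assms
proof (induction S arbitrary: G rule: finite_psubset_induct)
  case (psubset S)
  note Hall = psubset.prems(2)
  have fin: "finite (\<Union>(G ` T))" if "T \<subseteq> S" for T
    using that psubset.prems(1) finite_subset[OF that psubset.hyps] by blast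
  show ?case
  proof (cases "\<exists>T. T \<subset> S \<and> T \<noteq> {} \<and> card T = card (\<Union>(G ` T))")
    case True
    then obtain T where T: "T \<subset> S" "T \<noteq> {}" "card T = card (\<Union>(G ` T))" by blast
    have finT: "finite T" using T(1) psubset.hyps by (meson finite_subset psubset_imp_subset)
    obtain \<phi> where \<phi>: "inj_on \<phi> T" "\<And>v. v \<in> T \<Longrightarrow> \<phi> v \<in> G v"
      using psubset.IH[OF T(1), of G] psubset.prems T(1) by blast
    define G' where "G' v = G v - \<Union>(G ` T)" for v
    \<comment> \<open>Hall's condition for \<open>R \<union> T\<close>, less the tight count for
      \<open>T\<close>, leaves it for \<open>R\<close>.\<close>
    have "card R \<le> card (\<Union>(G' ` R))" if R: "R \<subseteq> S - T" for R
    proof -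
      have finR: "finite R" using R psubset.hyps by (meson finite_Diff finite_subset)
      have "card R + card T = card (R \<union> T)"
        using R finR finT by (subst card_Un_disjoint) auto
      also have "\<dots> \<le> card (\<Union>(G ` (R \<union> T)))"
        using R T(1) by (intro Hall) auto
      also have "\<Union>(G ` (R \<union> T)) = \<Union>(G' ` R) \<union> \<Union>(G ` T)"
        by (auto simp: G'_def)
      also have "card \<dots> \<le> card (\<Union>(G' ` R)) + card (\<Union>(G ` T))"
        by (rule card_Un_le)
      finally show ?thesis using T(3) by simp
    qed
    moreover have "S - T \<subset> S" using T by blast
    moreover have "finite (G' v)" if "v \<in> S - T" for v
      using psubset.prems(1) that by (simp add: G'_def)
    ultimately obtain \<psi> where \<psi>: "inj_on \<psi> (S - T)" "\<And>v. v \<in> S - T \<Longrightarrow> \<psi> v \<in> G' v"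
      using psubset.IH[of "S - T" G'] by blast
    have "inj_on (\<lambda>v. if v \<in> T then \<phi> v else \<psi> v) S"
      unfolding inj_on_def
    proof (intro ballI impI)
      fix u v assume uv: "u \<in> S" "v \<in> S" "(if u \<in> T then \<phi> u else \<psi> u) = (if v \<in> T then \<phi> v else \<psi> v)"
      have mix: "\<phi> x \<noteq> \<psi> y" if "x \<in> T" "y \<in> S - T" for x y
        using \<phi>(2)[OF that(1)] \<psi>(2)[OF that(2)] that(1) by (auto simp: G'_def)
      show "u = v"
        using uv mix[of u v] mix[of v u] \<phi>(1) \<psi>(1) by (auto simp: inj_on_def split: if_splits)
    qed
    moreover have "(if v \<in> T then \<phi> v else \<psi> v) \<in> G v" if "v \<in> S" for v
      using \<phi>(2)[of v] \<psi>(2)[of v] that by (auto simp: G'_def)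
    ultimately show ?thesis by blast
  next
    case False
    show ?thesis
    proof (cases "S = {}")
      case True then show ?thesis by simp
    next
      case nonempty: False
      then obtain v where v: "v \<in> S" by blast
      have "G v \<noteq> {}" using Hall[of "{v}"] v by auto
      then obtain x where x: "x \<in> G v" by blast
      define G' where "G' u = G u - {x}" for u
      have "card R \<le> card (\<Union>(G' ` R))" if R: "R \<subseteq> S - {v}" for R
      proof (cases "R = {}")
        case True then show ?thesis by simp
      next
        case nR: False
        have "R \<subset> S" using R v by blast
        then have "card R < card (\<Union>(G ` R))"
          using False nR Hall[of R] by (metis le_neq_implies_less psubset_imp_subset)
        moreover have "\<Union>(G' ` R) = \<Union>(G ` R) - {x}" by (auto simp: G'_def)
        moreover have "card (\<Union>(G ` R)) - 1 \<le> card (\<Union>(G ` R) - {x})"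
          by (simp add: card_Diff_singleton_if)
        ultimately show ?thesis by simp
      qed
      moreover have "S - {v} \<subset> S" using v by blast
      moreover have "finite (G' u)" if "u \<in> S - {v}" for u
        using psubset.prems(1) that by (simp add: G'_def)
      ultimately obtain \<psi> where \<psi>: "inj_on \<psi> (S - {v})" "\<And>u. u \<in> S - {v} \<Longrightarrow> \<psi> u \<in> G' u"
        using psubset.IH[of "S - {v}" G'] by blast
      have "inj_on (\<psi>(v := x)) S"
        using \<psi> by (auto simp: inj_on_def G'_def)
      moreover have "(\<psi>(v := x)) u \<in> G u" if "u \<in> S" for u
        using \<psi>(2)[of u] x that by (auto simp: G'_def)
      ultimately show ?thesis by blast
    qed
  qed
qed

lemma modular_withinD:
  assumes "modular_within n \<epsilon> f" "S \<subseteq> {1..n}" "T \<subseteq> {1..n}"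
  shows "\<bar>f S + f T - f (S \<union> T) - f (S \<inter> T)\<bar> \<le> \<epsilon>"
  using assms by (simp add: modular_within_def)

text \<open>Subtracting \<open>f {}\<close> makes the function almost additive on disjoint sets, so
  each of the \<open>card J - 1\<close> unions costs \<epsilon>. For empty \<open>J\<close> both
  sides are 0, the subtraction being truncated.\<close>

lemma modular_within_sum_disjoint:
  assumes mod: "modular_within n \<epsilon> f" and "finite J"
    and "\<And>j. j \<in> J \<Longrightarrow> A j \<subseteq> {1..n}" and "disjoint_family_on A J"
  shows "\<bar>(\<Sum>j\<in>J. f (A j) - f {}) - (f (\<Union>j\<in>J. A j) - f {})\<bar> \<le> real (card J - 1) * \<epsilon>"
  using assms(2-)
proof (induction J rule: finite_induct)
  case empty
  show ?case by simp
next
  case (insert j J)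
  let ?B = "\<Union>k\<in>J. A k"
  have IH: "\<bar>(\<Sum>k\<in>J. f (A k) - f {}) - (f ?B - f {})\<bar> \<le> real (card J - 1) * \<epsilon>"
  proof (rule insert.IH)
    show "disjoint_family_on A J"
      by (rule disjoint_family_on_mono[OF subset_insertI insert.prems(2)])
  qed (use insert.prems(1) in simp)
  show ?case
  proof (cases "J = {}")
    case True then show ?thesis by simp
  next
    case False
    have "A j \<inter> A k = {}" if "k \<in> J" for k
      by (rule disjoint_family_onD[OF insert.prems(2)]) (use insert.hyps(2) that in auto)
    then have disj: "A j \<inter> ?B = {}" by (simp add: Int_UN_distrib)
    have sub: "A j \<subseteq> {1..n}" "?B \<subseteq> {1..n}"
      using insert.prems(1) by (simp_all add: UN_subset_iff)
    have "\<bar>f (A j) + f ?B - f (A j \<union> ?B) - f {}\<bar> \<le> \<epsilon>"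
      using modular_withinD[OF mod sub] unfolding disj .
    with IH have "\<bar>(f (A j) - f {} + (\<Sum>k\<in>J. f (A k) - f {})) - (f (A j \<union> ?B) - f {})\<bar>
      \<le> real (card J - 1) * \<epsilon> + \<epsilon>"
      unfolding abs_le_iff by (simp add: algebra_simps)
    moreover have "real (card (insert j J) - 1) * \<epsilon> = real (card J - 1) * \<epsilon> + \<epsilon>"
    proof -
      obtain k where "card J = Suc k"
        using insert.hyps(1) False by (cases "card J") auto
      then show ?thesis using insert.hyps by (simp add: algebra_simps)
    qed
    moreover have "(\<Union>k\<in>insert j J. A k) = A j \<union> ?B" by simp
    moreover have "(\<Sum>k\<in>insert j J. f (A k) - f {}) = f (A j) - f {} + (\<Sum>k\<in>J. f (A k) - f {})"
      using insert.hyps by simp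
    ultimately show ?thesis by (simp only:)
  qed
qed

text \<open>The nodes \<open>h (v, k)\<close> with \<open>k < r\<close> are the neighbours of \<open>v\<close>. Every item \<open>i\<close> chooses a matching of the sets
  containing it; the part of \<open>A v\<close> sent along the edge \<open>(v, k)\<close> consists of the items that matched
  \<open>v\<close> along that edge, so the parts meeting in a node of \<open>W\<close> are disjoint.\<close>

lemma sum_le_by_regrouping:
  fixes h :: "'v \<times> nat \<Rightarrow> 'w"
  assumes mod: "modular_within n \<epsilon> f" and eps: "0 \<le> \<epsilon>"
    and fin: "finite V" "finite W" and A: "\<And>v. v \<in> V \<Longrightarrow> A v \<subseteq> {1..n}"
    and h: "\<And>v k. v \<in> V \<Longrightarrow> k < r \<Longrightarrow> h (v, k) \<in> W" and r: "0 < r"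
    and Hall: "\<And>i T. i \<in> {1..n} \<Longrightarrow> T \<subseteq> {v \<in> V. i \<in> A v} \<Longrightarrow> card T \<le> card (h ` (T \<times> {..<r}))"
    and M: "\<And>S. S \<subseteq> {1..n} \<Longrightarrow> f S \<le> M"
  shows "(\<Sum>v\<in>V. f (A v) - f {}) \<le> real ((2 * r - 1) * card V) * \<epsilon> + real (card W) * (M - f {})"
proof -
  define S where "S i = {v \<in> V. i \<in> A v}" for i
  have "\<exists>\<phi>. inj_on \<phi> (S i) \<and> (\<forall>v\<in>S i. \<phi> v \<in> h ` ({v} \<times> {..<r}))" if "i \<in> {1..n}" for i
  proof (rule Hall_matching)
    fix T assume T: "T \<subseteq> S i"
    have "(\<Union>v\<in>T. h ` ({v} \<times> {..<r})) = h ` (T \<times> {..<r})" by blast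
    then show "card T \<le> card (\<Union>v\<in>T. h ` ({v} \<times> {..<r}))"
      using Hall[OF that, of T] T by (simp add: S_def)
  qed (use fin in \<open>auto simp: S_def\<close>)
  note matching = this
  \<comment> \<open>\<open>\<kappa> v\<close> names the edge at \<open>v\<close> that the matching
    for item \<open>i\<close> uses.\<close>
  have "\<exists>\<kappa>. \<forall>v\<in>S i. \<kappa> v < r \<and> (\<forall>u\<in>S i. h (u, \<kappa> u) = h (v, \<kappa> v) \<longrightarrow> u = v)"
    if i: "i \<in> {1..n}" for i
  proof -
    obtain \<phi> where inj: "inj_on \<phi> (S i)" and \<phi>: "\<forall>v\<in>S i. \<phi> v \<in> h ` ({v} \<times> {..<r})"
      using matching[OF i] by (elim exE conjE)
    have "\<forall>v\<in>S i. \<exists>k. k < r \<and> \<phi> v = h (v, k)"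
    proof
      fix v assume "v \<in> S i"
      with \<phi> have "\<phi> v \<in> h ` ({v} \<times> {..<r})" by (rule bspec)
      then show "\<exists>k. k < r \<and> \<phi> v = h (v, k)" by auto
    qed
    from bchoice[OF this] obtain \<kappa> where \<kappa>: "\<forall>v\<in>S i. \<kappa> v < r \<and> \<phi> v = h (v, \<kappa> v)"
      by (elim exE)
    show ?thesis
    proof (intro exI[of _ \<kappa>] ballI conjI impI)
      fix v assume v: "v \<in> S i"
      then show "\<kappa> v < r" using bspec[OF \<kappa>] by simp
      fix u assume u: "u \<in> S i" and eq: "h (u, \<kappa> u) = h (v, \<kappa> v)"
      have "\<phi> u = \<phi> v" using bspec[OF \<kappa> u] bspec[OF \<kappa> v] eq by metis
      with inj show "u = v" using u v by (rule inj_onD)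
    qed
  qed
  then have "\<forall>i\<in>{1..n}. \<exists>\<kappa>. \<forall>v\<in>S i. \<kappa> v < r \<and> (\<forall>u\<in>S i. h (u, \<kappa> u) = h (v, \<kappa> v) \<longrightarrow> u = v)"
    by (rule ballI)
  from bchoice[OF this] obtain \<kappa> where \<kappa>_all:
    "\<forall>i\<in>{1..n}. \<forall>v\<in>S i. \<kappa> i v < r \<and> (\<forall>u\<in>S i. h (u, \<kappa> i u) = h (v, \<kappa> i v) \<longrightarrow> u = v)"
    by (elim exE)
  have \<kappa>: "\<kappa> i v < r" "\<And>u. u \<in> S i \<Longrightarrow> h (u, \<kappa> i u) = h (v, \<kappa> i v) \<Longrightarrow> u = v"
    if "i \<in> {1..n}" "v \<in> S i" for i v
    using bspec[OF bspec[OF \<kappa>_all that(1)] that(2)] by simp_all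
  define P where "P = (\<lambda>(v, k). {i \<in> A v. \<kappa> i v = k})"
  define E where "E = V \<times> {..<r}"
  define F where "F w = {e \<in> E. h e = w}" for w
  have finE: "finite E" and finF: "finite (F w)" for w using fin by (auto simp: E_def F_def)
  have Psub: "P e \<subseteq> {1..n}" if "e \<in> E" for e
    using that A by (auto simp: P_def E_def)
  have split: "f (A v) - f {} \<le> (\<Sum>k<r. f (P (v, k)) - f {}) + real (r - 1) * \<epsilon>" if v: "v \<in> V" for v
  proof -
    have "(\<Union>k<r. P (v, k)) = A v"
      using \<kappa>(1)[of _ v] A[OF v] v by (auto simp: P_def S_def)
    moreover have "disjoint_family_on (\<lambda>k. P (v, k)) {..<r}"
      by (auto simp: disjoint_family_on_def P_def)
    ultimately show ?thesis
      using modular_within_sum_disjoint[OF mod, of "{..<r}" "\<lambda>k. P (v, k)"] Psub v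
      by (simp add: E_def abs_le_iff)
  qed
  have merge: "(\<Sum>e\<in>F w. f (P e) - f {}) \<le> M - f {} + real (card (F w)) * \<epsilon>" for w
  proof -
    \<comment> \<open>An item common to two parts at \<open>w\<close> would use \<open>w\<close>
      twice in its matching.\<close>
    have "disjoint_family_on P (F w)"
      unfolding disjoint_family_on_def
    proof (intro ballI impI)
      fix d e assume de: "d \<in> F w" "e \<in> F w" "d \<noteq> e"
      show "P d \<inter> P e = {}"
      proof (rule ccontr)
        assume "P d \<inter> P e \<noteq> {}"
        then obtain i where i: "i \<in> P d" "i \<in> P e" by blast
        then have "i \<in> {1..n}" using Psub[of d] de(1) by (auto simp only: F_def)
        with i de show False
          using \<kappa>(2)[of i "fst d" "fst e"] by (cases d; cases e) (auto simp: P_def F_def E_def S_def)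
      qed
    qed
    then have "\<bar>(\<Sum>e\<in>F w. f (P e) - f {}) - (f (\<Union>e\<in>F w. P e) - f {})\<bar> \<le> real (card (F w) - 1) * \<epsilon>"
      using Psub by (intro modular_within_sum_disjoint[OF mod finF]) (auto simp: F_def)
    moreover have "f (\<Union>e\<in>F w. P e) \<le> M" using Psub by (intro M) (auto simp: F_def)
    moreover have "real (card (F w) - 1) * \<epsilon> \<le> real (card (F w)) * \<epsilon>"
      using eps by (intro mult_right_mono) auto
    ultimately show ?thesis by linarith
  qed
  have EW: "E = (\<Union>w\<in>W. F w)" using h by (auto simp: E_def F_def)
  have sumE: "(\<Sum>e\<in>E. g e) = (\<Sum>w\<in>W. \<Sum>e\<in>F w. g e)" for g :: "'v \<times> nat \<Rightarrow> real"
    unfolding EW using fin finF by (subst sum.UNION_disjoint) (auto simp: F_def)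
  have cardE: "(\<Sum>w\<in>W. real (card (F w))) = real (r * card V)"
    using sumE[of "\<lambda>_. 1"] by (simp add: E_def card_cartesian_product mult.commute)
  have "(\<Sum>v\<in>V. f (A v) - f {}) \<le> (\<Sum>v\<in>V. (\<Sum>k<r. f (P (v, k)) - f {}) + real (r - 1) * \<epsilon>)"
    by (intro sum_mono split)
  also have "\<dots> = (\<Sum>e\<in>E. f (P e) - f {}) + real (card V) * real (r - 1) * \<epsilon>"
    by (simp add: sum.distrib E_def sum.cartesian_product case_prod_beta)
  also have "(\<Sum>e\<in>E. f (P e) - f {}) \<le> (\<Sum>w\<in>W. M - f {} + real (card (F w)) * \<epsilon>)"
    unfolding sumE by (intro sum_mono merge)
  also have "\<dots> = real (card W) * (M - f {}) + real (r * card V) * \<epsilon>"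
    by (simp add: sum.distrib cardE flip: sum_distrib_right)
  \<comment> \<open>Per set, splitting costs \<open>r - 1\<close> and merging, charged once per
    edge, costs \<open>r\<close>: together \<open>2 * r - 1\<close>.\<close>
  finally show ?thesis
    using r by (simp add: algebra_simps of_nat_diff)
qed

section \<open>A random graph\<close>

text \<open>\<open>z\<close> times a partial sum of the differentiated geometric series, whose terms
  are nonnegative.\<close>

lemma sum_times_power_le:
  fixes z :: real
  assumes "0 \<le> z" "z < 1"
  shows "(\<Sum>t\<in>{1..N}. real t * z ^ t) \<le> z / (1 - z)\<^sup>2"
proof -
  have sums: "(\<lambda>t. real (Suc t) * z ^ t) sums (1 / (1 - z)\<^sup>2)"
    using geometric_deriv_sums[of z] assms by simp
  have "(\<Sum>t\<in>{1..N}. real t * z ^ t) = z * (\<Sum>t<N. real (Suc t) * z ^ t)"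
    by (simp add: sum.atLeast1_atMost_eq sum_distrib_left mult_ac del: of_nat_Suc)
  also have "\<dots> \<le> z * (1 / (1 - z)\<^sup>2)"
    using sum_le_suminf[OF sums_summable[OF sums], of "{..<N}"] sums_unique[OF sums] assms
    by (intro mult_left_mono) auto
  finally show ?thesis by simp
qed

text \<open>\<open>real t ^ t / fact t\<close> is a single term of the exponential series at
  \<open>t\<close>, hence at most \<open>exp 1 ^ t\<close>.\<close>

lemma power_self_le_fact: "real t ^ t \<le> 3 ^ t * fact t"
proof -
  have "real t ^ t / fact t \<le> exp (real t)"
    using sum_le_suminf[OF summable_exp[of "real t"], of "{t}"]
    by (simp add: exp_def divide_inverse mult.commute)
  also have "\<dots> = exp 1 ^ t"
    using exp_of_nat_mult[of t "1 :: real"] by simp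
  also have "\<dots> \<le> 3 ^ t"
    by (intro power_mono exp_le) auto
  finally show ?thesis
    by (simp add: divide_le_eq)
qed

text \<open>The probability that some \<open>t\<close> of \<open>N\<close> given nodes have all their \<open>3 t\<close> random neighbours inside
  some \<open>t\<close>-element subset of a set of size \<open>4 N\<close>.\<close>

lemma collision_probability_le:
  assumes "1 \<le> t" "t \<le> N"
  shows "real (N choose t) * real (4 * N choose t) * (real t / real (4 * N)) ^ (3 * t)
    \<le> real t * (9 / 16) ^ t / real N"
proof -
  have N: "0 < real N" using assms by simp
  have "real (N choose t) * fact t \<le> real N ^ t" "real (4 * N choose t) * fact t \<le> real (4 * N) ^ t"
    using binomial_fact_pow[of N t] binomial_fact_pow[of "4 * N" t]
    by (metis of_nat_fact of_nat_le_iff of_nat_mult of_nat_power)+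
  then have b: "real (N choose t) \<le> real N ^ t / fact t" "real (4 * N choose t) \<le> real (4 * N) ^ t / fact t"
    by (simp_all add: field_simps)
  have "real (N choose t) * real (4 * N choose t) * (real t / real (4 * N)) ^ (3 * t)
    \<le> (real N ^ t / fact t) * (real (4 * N) ^ t / fact t) * (real t / real (4 * N)) ^ (3 * t)"
    using b by (intro mult_right_mono mult_mono) auto
  \<comment> \<open>The power of \<open>4 * N\<close> occurs in one numerator but three times in the
    denominator, the other numerator having only \<open>N\<close>; this leaves \<open>1 / 16\<close>
    and \<open>1 / N\<close> to the power \<open>t\<close>.\<close>
  also have "\<dots> = (real t ^ t / fact t)\<^sup>2 * (real t / real N) ^ t * (1 / 16) ^ t"
  proof -
    have ident: "a / c * (d * a / c) * (b / (d * a)) ^ 3 = (b / c)\<^sup>2 * (b / a) * (1 / (d * d))"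
      if "a \<noteq> 0" "c \<noteq> 0" "d \<noteq> 0" for a b c d :: real
      using that by (simp add: field_simps power2_eq_square power3_eq_cube)
    have "(real t / real (4 * N)) ^ (3 * t) = (real t ^ t / (4 ^ t * real N ^ t)) ^ 3"
      by (subst mult.commute[of 3 t]) (simp only: power_mult power_divide of_nat_mult power_mult_distrib of_nat_numeral)
    moreover have "(1 / 16 :: real) ^ t = 1 / (4 ^ t * 4 ^ t)"
      by (simp add: power_divide power_mult_distrib[symmetric])
    ultimately show ?thesis
      using ident[of "real N ^ t" "fact t" "4 ^ t" "real t ^ t"] N
      by (simp only: power_divide[of "real t" "real N"] of_nat_mult power_mult_distrib of_nat_numeral) simp
  qed
  also have "\<dots> \<le> (3 ^ t)\<^sup>2 * (real t / real N) ^ t * (1 / 16) ^ t"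
    using power_self_le_fact[of t]
    by (intro mult_right_mono power_mono) (auto simp: divide_le_eq)
  also have "\<dots> = (9 / 16) ^ t * (real t / real N) ^ t"
  proof -
    have "((3 :: real) ^ t)\<^sup>2 = 9 ^ t"
      by (simp add: power2_eq_square power_mult_distrib[symmetric])
    then show ?thesis by (simp add: power_divide)
  qed
  \<comment> \<open>One factor \<open>t / N\<close> of the power is kept; its \<open>1 / N\<close>
    later beats the number of items in the union bound.\<close>
  also have "\<dots> \<le> (9 / 16) ^ t * (real t / real N)"
    using assms power_decreasing[of 1 t "real t / real N"] by (intro mult_left_mono) auto
  finally show ?thesis by (simp add: mult.commute)
qed

text \<open>Probability is treated by counting: \<open>h (v, k)\<close> is the end of edge
  \<open>k\<close> at \<open>v\<close>, parallel edges being allowed. The maps in question form a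
  product with factor \<open>B\<close> on the edges at \<open>T\<close> and \<open>W\<close>
  elsewhere.\<close>

lemma card_maps_into:
  assumes "finite V" "finite W" "T \<subseteq> V" "B \<subseteq> W" "W \<noteq> {}"
  shows "real (card {h \<in> (V \<times> {..<r}) \<rightarrow>\<^sub>E W. h ` (T \<times> {..<r}) \<subseteq> B})
    = (real (card B) / real (card W)) ^ (r * card T) * real (card ((V \<times> {..<r}) \<rightarrow>\<^sub>E W))"
proof -
  let ?E = "V \<times> {..<r}" and ?T = "T \<times> {..<r}"
  have finE: "finite ?E" using assms(1) by simp
  have TE: "?T \<subseteq> ?E" using assms(3) by auto
  have cT: "card ?T = r * card T" by (simp add: card_cartesian_product)
  have "{h \<in> ?E \<rightarrow>\<^sub>E W. h ` ?T \<subseteq> B} = (\<Pi>\<^sub>E e\<in>?E. if e \<in> ?T then B else W)"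
  proof (intro subset_antisym subsetI)
    fix h assume "h \<in> {h \<in> ?E \<rightarrow>\<^sub>E W. h ` ?T \<subseteq> B}"
    then have h: "h \<in> ?E \<rightarrow>\<^sub>E W" "h ` ?T \<subseteq> B" by simp_all
    show "h \<in> (\<Pi>\<^sub>E e\<in>?E. if e \<in> ?T then B else W)"
    proof (rule PiE_I)
      fix e assume "e \<in> ?E"
      with h(1) have "h e \<in> W" by (rule PiE_mem)
      moreover have "h e \<in> B" if "e \<in> ?T" using h(2) imageI[OF that] by (rule subsetD)
      ultimately show "h e \<in> (if e \<in> ?T then B else W)" by simp
    qed (rule PiE_arb[OF h(1)])
  next
    fix h assume h: "h \<in> (\<Pi>\<^sub>E e\<in>?E. if e \<in> ?T then B else W)"
    have mem: "h e \<in> (if e \<in> ?T then B else W)" if "e \<in> ?E" for e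
      using PiE_mem[OF h that] .
    have "h \<in> ?E \<rightarrow>\<^sub>E W"
    proof (rule PiE_I)
      fix e assume "e \<in> ?E"
      from mem[OF this] show "h e \<in> W" using assms(4) by (auto split: if_splits)
    qed (rule PiE_arb[OF h])
    moreover have "h ` ?T \<subseteq> B"
    proof (rule image_subsetI)
      fix e assume "e \<in> ?T"
      then show "h e \<in> B" using mem[of e] TE by (simp add: subsetD del: mem_Sigma_iff)
    qed
    ultimately show "h \<in> {h \<in> ?E \<rightarrow>\<^sub>E W. h ` ?T \<subseteq> B}" by simp
  qed
  then have "card {h \<in> ?E \<rightarrow>\<^sub>E W. h ` ?T \<subseteq> B} = (\<Prod>e\<in>?E. card (if e \<in> ?T then B else W))"
    using finE by (simp add: card_PiE)
  also have "\<dots> = (\<Prod>e\<in>?T. card (if e \<in> ?T then B else W)) * (\<Prod>e\<in>?E - ?T. card (if e \<in> ?T then B else W))"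
    unfolding prod.subset_diff[OF TE finE] by (rule mult.commute)
  also have "\<dots> = card B ^ (r * card T) * card W ^ card (?E - ?T)"
    by (simp add: cT del: mem_Sigma_iff)
  finally have 1: "card {h \<in> ?E \<rightarrow>\<^sub>E W. h ` ?T \<subseteq> B} = card B ^ (r * card T) * card W ^ card (?E - ?T)" .
  have "card ?E = r * card T + card (?E - ?T)"
    using card_Diff_subset[OF finite_subset[OF TE finE] TE] card_mono[OF finE TE] cT by simp
  then have 2: "card (?E \<rightarrow>\<^sub>E W) = card W ^ (r * card T) * card W ^ card (?E - ?T)"
    using finE by (simp add: card_PiE power_add)
  have "card W \<noteq> 0" using assms by simp
  then show ?thesis unfolding 1 2 by (simp add: power_divide)
qed

text \<open>Only finitely many prescribed sets \<open>S i\<close> have to be matched, so a union bound over \<open>I\<close>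
  suffices once \<open>N\<close> is large; no expansion of all small subsets of \<open>V\<close> is required.\<close>

lemma exists_matching_map:
  assumes fin: "finite I" "finite V" and S: "\<And>i. i \<in> I \<Longrightarrow> S i \<subseteq> V" "\<And>i. i \<in> I \<Longrightarrow> card (S i) \<le> N"
    and N: "3 * card I < N"
  shows "\<exists>h \<in> (V \<times> {..<3}) \<rightarrow>\<^sub>E {..<4 * N}. \<forall>i\<in>I. \<forall>T\<subseteq>S i. card T \<le> card (h ` (T \<times> {..<3 :: nat}))"
proof (rule ccontr)
  assume none: "\<not> ?thesis"
  define W where "W = {..<4 * N}"
  define \<Omega> where "\<Omega> = (V \<times> {..<3 :: nat}) \<rightarrow>\<^sub>E W"
  define bad where "bad T B = {h \<in> \<Omega>. h ` (T \<times> {..<3}) \<subseteq> B}" for T B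
  define sub where "sub X t = {T. T \<subseteq> X \<and> card T = t}" for X :: "'b set" and t
  define sub' where "sub' t = {B. B \<subseteq> W \<and> card B = t}" for t
  have W: "finite W" "W \<noteq> {}" "card W = 4 * N" using N by (simp_all add: W_def lessThan_empty_iff bot_nat_def)
  have fS: "finite (S i)" if "i \<in> I" for i using S(1)[OF that] fin(2) by (rule finite_subset)
  have fin\<Omega>: "finite \<Omega>" unfolding \<Omega>_def using fin W by (intro finite_PiE) auto
  have pos: "0 < card \<Omega>"
    using fin W N by (simp add: \<Omega>_def card_PiE)
  have finsub: "finite (sub (S i) t)" if "i \<in> I" for i t
    using fS[OF that] by (simp add: sub_def)
  have finsub': "finite (sub' t)" for t using W(1) by (simp add: sub'_def)
  have cover: "\<Omega> \<subseteq> (\<Union>i\<in>I. \<Union>t\<in>{1..N}. \<Union>T\<in>sub (S i) t. \<Union>B\<in>sub' t. bad T B)"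
  proof
    fix h assume h: "h \<in> \<Omega>"
    with none obtain i T where iT: "i \<in> I" "T \<subseteq> S i" "card (h ` (T \<times> {..<3})) < card T"
      unfolding \<Omega>_def W_def by (meson not_le)
    have fT: "finite T" using fS[OF iT(1)] iT(2) by (rule finite_subset[rotated])
    have tN: "card T \<le> N"
      using card_mono[OF fS[OF iT(1)] iT(2)] S(2)[OF iT(1)] by simp
    have "h ` (T \<times> {..<3}) \<subseteq> W"
    proof (rule image_subsetI)
      fix e assume "e \<in> T \<times> {..<3 :: nat}"
      then have "e \<in> V \<times> {..<3}" using iT(2) S(1)[OF iT(1)] by auto
      with h show "h e \<in> W" unfolding \<Omega>_def by (rule PiE_mem)
    qed
    \<comment> \<open>A violating \<open>T\<close> has fewer than \<open>card T\<close> neighbours;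
      padding them to exactly \<open>card T\<close> nodes leaves only pairs of equal size for the
      union bound.\<close>
    then obtain B where B: "h ` (T \<times> {..<3}) \<subseteq> B" "B \<subseteq> W" "card B = card T"
      using exists_subset_between[of "h ` (T \<times> {..<3})" "card T" W] iT(3) tN W by auto
    have "h \<in> bad T B" using h B(1) by (simp add: bad_def)
    moreover have "B \<in> sub' (card T)" using B by (simp add: sub'_def)
    moreover have "T \<in> sub (S i) (card T)" using iT(2) by (simp add: sub_def)
    moreover have "card T \<in> {1..N}" using tN iT(3) by simp
    ultimately show "h \<in> (\<Union>i\<in>I. \<Union>t\<in>{1..N}. \<Union>T\<in>sub (S i) t. \<Union>B\<in>sub' t. bad T B)"
      using iT(1) by blast
  qed
  have finbad: "finite (bad T B)" for T B using fin\<Omega> by (simp add: bad_def)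
  have fix_t: "real (\<Sum>T\<in>sub (S i) t. \<Sum>B\<in>sub' t. card (bad T B)) \<le> real t * (9 / 16) ^ t / real N * real (card \<Omega>)"
    if i: "i \<in> I" and t: "t \<in> {1..N}" for i t
  proof -
    have "real (card (bad T B)) = (real t / real (4 * N)) ^ (3 * t) * real (card \<Omega>)"
      if "T \<in> sub (S i) t" "B \<in> sub' t" for T B
      using card_maps_into[OF fin(2) W(1) _ _ W(2), of T B 3] that S(1)[OF i] W(3)
      by (auto simp: bad_def \<Omega>_def sub_def sub'_def)
    then have "real (\<Sum>T\<in>sub (S i) t. \<Sum>B\<in>sub' t. card (bad T B))
      = (\<Sum>T\<in>sub (S i) t. \<Sum>B\<in>sub' t. (real t / real (4 * N)) ^ (3 * t) * real (card \<Omega>))"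
      unfolding of_nat_sum by (intro sum.cong refl) auto
    also have "\<dots> = real (card (sub (S i) t)) * real (card (sub' t)) * (real t / real (4 * N)) ^ (3 * t) * real (card \<Omega>)"
      by simp
    also have "card (sub (S i) t) = card (S i) choose t"
      using n_subsets[OF fS[OF i]] by (simp add: sub_def)
    also have "card (sub' t) = 4 * N choose t"
      using n_subsets[OF W(1)] W(3) by (simp add: sub'_def)
    also have "real (card (S i) choose t) * real (4 * N choose t) * (real t / real (4 * N)) ^ (3 * t) * real (card \<Omega>)
      \<le> real (N choose t) * real (4 * N choose t) * (real t / real (4 * N)) ^ (3 * t) * real (card \<Omega>)"
      using binomial_right_mono[OF S(2)[OF i], of t] by (intro mult_right_mono) simp_all
    also have "\<dots> \<le> real t * (9 / 16) ^ t / real N * real (card \<Omega>)"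
      using t by (intro mult_right_mono collision_probability_le) simp_all
    finally show ?thesis .
  qed
  have "card \<Omega> \<le> card (\<Union>i\<in>I. \<Union>t\<in>{1..N}. \<Union>T\<in>sub (S i) t. \<Union>B\<in>sub' t. bad T B)"
    using fin finsub finsub' finbad by (intro card_mono[OF _ cover] finite_UN_I) simp_all
  also have "\<dots> \<le> (\<Sum>i\<in>I. \<Sum>t\<in>{1..N}. \<Sum>T\<in>sub (S i) t. \<Sum>B\<in>sub' t. card (bad T B))"
    by (intro order_trans[OF card_UN_le sum_mono] order_refl fin finsub finsub' finite_atLeastAtMost)
  finally have "real (card \<Omega>) \<le> real (\<Sum>i\<in>I. \<Sum>t\<in>{1..N}. \<Sum>T\<in>sub (S i) t. \<Sum>B\<in>sub' t. card (bad T B))"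
    by (simp only: of_nat_le_iff)
  also have "\<dots> \<le> (\<Sum>i\<in>I. \<Sum>t\<in>{1..N}. real t * (9 / 16) ^ t / real N * real (card \<Omega>))"
    unfolding of_nat_sum[of _ I] of_nat_sum[of _ "{1..N}"] by (intro sum_mono fix_t)
  also have "\<dots> = real (card I) * (\<Sum>t\<in>{1..N}. real t * (9 / 16) ^ t) * (real (card \<Omega>) / real N)"
  proof -
    have "(\<Sum>t\<in>{1..N}. real t * (9 / 16) ^ t / real N * real (card \<Omega>))
      = (\<Sum>t\<in>{1..N}. real t * (9 / 16) ^ t) * (real (card \<Omega>) / real N)"
      unfolding sum_distrib_right by (intro sum.cong) simp_all
    then show ?thesis by (simp only: sum_constant mult.assoc)
  qed
  \<comment> \<open>At \<open>9 / 16\<close> the series bound is \<open>144 / 49 < 3\<close>, the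
    source of the 3 in \<open>3 * card I < N\<close>.\<close>
  also have "\<dots> \<le> real (card I) * 3 * (real (card \<Omega>) / real N)"
    using order_trans[OF sum_times_power_le[of "9 / 16" N], of 3]
    by (intro mult_right_mono mult_left_mono) (simp_all add: power2_eq_square)
  also have "\<dots> < real (card \<Omega>)"
  proof -
    have "real (3 * card I) < real N" using N by (simp only: of_nat_less_iff)
    then have "real (card I) * 3 * real (card \<Omega>) < real N * real (card \<Omega>)"
      using pos by (intro mult_strict_right_mono) simp_all
    then show ?thesis using N by (simp add: divide_simps mult_ac)
  qed
  finally show False by simp
qed

section \<open>Bounding the dual gap\<close>

text \<open>Each \<open>A j\<close> is taken about \<open>16 * N * \<alpha> j\<close> times. At most
  \<open>16 * N\<close> sets arise, each item lies in at most \<open>N\<close> of them, and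
  regrouping with degree 3 into \<open>4 * N\<close> sets costs 5 \<epsilon> per set and leaves a
  quarter of \<open>M - f {}\<close>. The rounding error is bounded independently of
  \<open>N\<close>.\<close>

lemma weighted_average_le:
  fixes \<alpha> :: "'j \<Rightarrow> real"
  assumes mod: "modular_within n \<epsilon> f" and eps: "0 \<le> \<epsilon>"
    and J: "finite J" "\<And>j. j \<in> J \<Longrightarrow> A j \<subseteq> {1..n}"
    and \<alpha>: "\<And>j. j \<in> J \<Longrightarrow> 0 \<le> \<alpha> j" "(\<Sum>j\<in>J. \<alpha> j) \<le> 1"
    and marginal: "\<And>i. i \<in> {1..n} \<Longrightarrow> (\<Sum>j\<in>J. \<alpha> j * of_bool (i \<in> A j)) \<le> 1 / 16"
    and M: "\<And>S. S \<subseteq> {1..n} \<Longrightarrow> f S \<le> M"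
  shows "(\<Sum>j\<in>J. \<alpha> j * (f (A j) - f {})) \<le> 5 * \<epsilon> + (M - f {}) / 4"
proof -
  define g where "g j = f (A j) - f {}" for j
  define x where "x = (\<Sum>j\<in>J. \<alpha> j * g j)"
  define y where "y = 5 * \<epsilon> + (M - f {}) / 4"
  define D where "D = (\<Sum>j\<in>J. \<bar>g j\<bar>)"
  have key: "real (16 * N) * x - D \<le> real (16 * N) * y" if N: "3 * n < N" for N :: nat
  proof -
    \<comment> \<open>Rounding down preserves the bounds on the number of all copies and of those
      containing a given item.\<close>
    define c where "c j = nat \<lfloor>real (16 * N) * \<alpha> j\<rfloor>" for j
    define V where "V = (SIGMA j:J. {..<c j})"
    define S where "S i = (SIGMA j:{j \<in> J. i \<in> A j}. {..<c j})" for i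
    have c: "real (c j) \<le> real (16 * N) * \<alpha> j" "real (16 * N) * \<alpha> j \<le> real (c j) + 1" if "j \<in> J" for j
      using \<alpha>(1)[OF that] unfolding c_def by (simp_all add: of_nat_nat)
    have finV: "finite V" using J(1) by (simp add: V_def)
    have cV: "card V \<le> 16 * N"
    proof -
      have "real (card V) = (\<Sum>j\<in>J. real (c j))" using J(1) by (simp add: V_def)
      also have "\<dots> \<le> (\<Sum>j\<in>J. real (16 * N) * \<alpha> j)" by (intro sum_mono c)
      also have "\<dots> \<le> real (16 * N) * 1"
        unfolding sum_distrib_left[symmetric] by (intro mult_left_mono \<alpha>) simp
      finally show ?thesis by simp
    qed
    have cS: "card (S i) \<le> N" if i: "i \<in> {1..n}" for i
    proof -
      have "real (card (S i)) = (\<Sum>j\<in>{j \<in> J. i \<in> A j}. real (c j))" using J(1) by (simp add: S_def)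
      also have "\<dots> = (\<Sum>j\<in>J. real (c j) * of_bool (i \<in> A j))"
        by (intro sum.mono_neutral_cong_left J(1)) auto
      also have "\<dots> \<le> (\<Sum>j\<in>J. real (16 * N) * \<alpha> j * of_bool (i \<in> A j))"
        by (intro sum_mono mult_right_mono c) simp_all
      also have "\<dots> = real (16 * N) * (\<Sum>j\<in>J. \<alpha> j * of_bool (i \<in> A j))"
        by (simp add: sum_distrib_left mult.assoc)
      also have "\<dots> \<le> real (16 * N) * (1 / 16)"
        by (intro mult_left_mono marginal i) simp
      finally show ?thesis by simp
    qed
    have S_eq: "S i = {v \<in> V. i \<in> A (fst v)}" for i by (auto simp: S_def V_def)
    have "\<exists>h \<in> (V \<times> {..<3}) \<rightarrow>\<^sub>E {..<4 * N}. \<forall>i\<in>{1..n}. \<forall>T\<subseteq>S i. card T \<le> card (h ` (T \<times> {..<3 :: nat}))"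
      using N finV cS by (intro exists_matching_map) (auto simp: S_eq)
    then obtain h where h: "h \<in> (V \<times> {..<3}) \<rightarrow>\<^sub>E {..<4 * N}"
      "\<And>i T. i \<in> {1..n} \<Longrightarrow> T \<subseteq> S i \<Longrightarrow> card T \<le> card (h ` (T \<times> {..<3 :: nat}))"
      by auto
    have "(\<Sum>v\<in>V. f (A (fst v)) - f {}) \<le> real ((2 * 3 - 1) * card V) * \<epsilon> + real (card {..<4 * N}) * (M - f {})"
    proof (rule sum_le_by_regrouping[OF mod eps finV])
      show "A (fst v) \<subseteq> {1..n}" if "v \<in> V" for v
        by (rule J(2)) (use that in \<open>auto simp: V_def\<close>)
      show "h (v, k) \<in> {..<4 * N}" if "v \<in> V" "k < 3" for v k
        using that by (intro PiE_mem[OF h(1)]) simp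
      show "card T \<le> card (h ` (T \<times> {..<3}))" if "i \<in> {1..n}" "T \<subseteq> {v \<in> V. i \<in> A (fst v)}" for i T
        using h(2) that unfolding S_eq .
    qed (use M in simp_all)
    also have "\<dots> \<le> real (5 * (16 * N)) * \<epsilon> + real (4 * N) * (M - f {})"
    proof -
      have "real (5 * card V) * \<epsilon> \<le> real (5 * (16 * N)) * \<epsilon>"
        using cV eps by (intro mult_right_mono) simp_all
      then show ?thesis by simp
    qed
    also have "\<dots> = real (16 * N) * y" by (simp add: y_def field_simps)
    also have "(\<Sum>v\<in>V. f (A (fst v)) - f {}) = (\<Sum>j\<in>J. real (c j) * g j)"
      using sum.Sigma[of J "\<lambda>j. {..<c j}" "\<lambda>j k. f (A j) - f {}"] J(1)
      by (simp add: V_def g_def case_prod_beta)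
    finally have upper: "(\<Sum>j\<in>J. real (c j) * g j) \<le> real (16 * N) * y" .
    have "real (16 * N) * x - (\<Sum>j\<in>J. real (c j) * g j) = (\<Sum>j\<in>J. (real (16 * N) * \<alpha> j - real (c j)) * g j)"
      by (simp add: x_def sum_distrib_left left_diff_distrib sum_subtractf mult.assoc)
    also have "\<dots> \<le> D"
      unfolding D_def
    proof (rule sum_mono)
      fix j assume "j \<in> J"
      from c[OF this] have "\<bar>real (16 * N) * \<alpha> j - real (c j)\<bar> \<le> 1" by simp
      then have "\<bar>real (16 * N) * \<alpha> j - real (c j)\<bar> * \<bar>g j\<bar> \<le> 1 * \<bar>g j\<bar>"
        by (intro mult_right_mono) simp_all
      then show "(real (16 * N) * \<alpha> j - real (c j)) * g j \<le> \<bar>g j\<bar>"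
        using abs_ge_self[of "(real (16 * N) * \<alpha> j - real (c j)) * g j"] by (simp only: abs_mult)
    qed
    finally show ?thesis using upper by simp
  qed
  have "x \<le> y"
  proof (rule ccontr)
    assume "\<not> x \<le> y"
    then have d: "0 < x - y" by simp
    obtain k :: nat where k: "D < real k * (x - y)"
      using reals_Archimedean3[OF d] by blast
    \<comment> \<open>\<open>k\<close> outgrows the rounding error and \<open>3 * n + 1\<close>
      secures the condition of \<open>key\<close>.\<close>
    define N where "N = k + 3 * n + 1"
    have "real k * (x - y) \<le> real (16 * N) * (x - y)"
      using d by (intro mult_right_mono) (simp_all add: N_def)
    also have "\<dots> \<le> D" using key[of N] by (simp add: N_def algebra_simps)
    finally show False using k by simp
  qed
  then show ?thesis by (simp add: x_def y_def g_def)
qed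

lemma modular_within_uminus: "modular_within n \<epsilon> f \<Longrightarrow> modular_within n \<epsilon> (\<lambda>S. - f S)"
  unfolding modular_within_def by (auto simp: abs_le_iff algebra_simps)

text \<open>For independent \<open>P\<close>, \<open>Q\<close> with a common marginal \<open>q\<close>, an item lies in \<open>P - Q\<close> and in
  \<open>Q - P\<close> with probability \<open>q (1 - q) \<le> 1/4\<close>, hence in the intersection of two independent copies
  with probability at most \<open>1/16\<close>, the density that \<open>weighted_average_le\<close> can handle.\<close>

lemma dual_gap_le:
  assumes mod: "modular_within n \<epsilon> f" and eps: "0 \<le> \<epsilon>"
    and M: "\<And>S. S \<subseteq> {1..n} \<Longrightarrow> \<bar>f S\<bar> \<le> M"
    and w: "\<And>S. S \<subseteq> {1..n} \<Longrightarrow> 0 \<le> w S" "\<And>S. S \<subseteq> {1..n} \<Longrightarrow> 0 \<le> w' S"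
      "(\<Sum>S\<in>Pow {1..n}. w S) = 1" "(\<Sum>S\<in>Pow {1..n}. w' S) = 1"
      "\<And>i. i \<in> {1..n} \<Longrightarrow>
        (\<Sum>S\<in>Pow {1..n}. w S * of_bool (i \<in> S)) = (\<Sum>S\<in>Pow {1..n}. w' S * of_bool (i \<in> S))"
  shows "2 * ((\<Sum>S\<in>Pow {1..n}. w S * f S) - (\<Sum>S\<in>Pow {1..n}. w' S * f S)) \<le> 5 / 2 * M + 16 * \<epsilon>"
proof -
  let ?F = "Pow {1..n}"
  \<comment> \<open>\<open>\<beta>\<close> is the law of an independent pair (P, Q) and
    \<open>\<alpha>\<close> that of two independent copies; \<open>A\<close> intersects the two
    differences P - Q, and \<open>B\<close> the two differences Q - P.\<close>
  define X where "X = ?F \<times> ?F"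
  define \<beta> where "\<beta> x = w (fst x) * w' (snd x)" for x
  define J where "J = X \<times> X"
  define \<alpha> where "\<alpha> j = \<beta> (fst j) * \<beta> (snd j)" for j
  define A where "A j = (fst (fst j) - snd (fst j)) \<inter> (fst (snd j) - snd (snd j))"
    for j :: "(nat set \<times> nat set) \<times> (nat set \<times> nat set)"
  define B where "B j = (snd (fst j) - fst (fst j)) \<inter> (snd (snd j) - fst (snd j))"
    for j :: "(nat set \<times> nat set) \<times> (nat set \<times> nat set)"
  define u where "u x = f (fst x) - f (snd x)" for x
  have fin: "finite X" "finite J" by (simp_all add: X_def J_def)
  have \<beta>0: "0 \<le> \<beta> x" if "x \<in> X" for x using that w(1,2) by (auto simp: X_def \<beta>_def)
  have \<alpha>0: "0 \<le> \<alpha> j" if "j \<in> J" for j using that \<beta>0 by (auto simp: J_def \<alpha>_def)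
  have prod_X: "(\<Sum>x\<in>X. \<beta> x * (s (fst x) * t (snd x))) = (\<Sum>S\<in>?F. w S * s S) * (\<Sum>S\<in>?F. w' S * t S)"
    for s t :: "nat set \<Rightarrow> real"
    unfolding X_def \<beta>_def sum_product sum.cartesian_product
    by (intro sum.cong) (auto simp: algebra_simps)
  have prod_J: "(\<Sum>j\<in>J. \<alpha> j * (s (fst j) * t (snd j))) = (\<Sum>x\<in>X. \<beta> x * s x) * (\<Sum>x\<in>X. \<beta> x * t x)"
    for s t :: "nat set \<times> nat set \<Rightarrow> real"
    unfolding J_def \<alpha>_def sum_product sum.cartesian_product
    by (intro sum.cong) (auto simp: algebra_simps)
  have \<beta>1: "(\<Sum>x\<in>X. \<beta> x) = 1" using prod_X[of "\<lambda>_. 1" "\<lambda>_. 1"] w(3,4) by simp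
  have \<alpha>1: "(\<Sum>j\<in>J. \<alpha> j) = 1" using prod_J[of "\<lambda>_. 1" "\<lambda>_. 1"] \<beta>1 by simp
  have mean_u: "(\<Sum>x\<in>X. \<beta> x * u x) = (\<Sum>S\<in>?F. w S * f S) - (\<Sum>S\<in>?F. w' S * f S)"
    using prod_X[of f "\<lambda>_. 1"] prod_X[of "\<lambda>_. 1" f] w(3,4)
    by (simp add: u_def right_diff_distrib sum_subtractf)
  have mean_uu: "(\<Sum>j\<in>J. \<alpha> j * (u (fst j) + u (snd j))) = 2 * (\<Sum>x\<in>X. \<beta> x * u x)"
    using prod_J[of u "\<lambda>_. 1"] prod_J[of "\<lambda>_. 1" u] \<beta>1
    by (simp add: distrib_left sum.distrib)
  have quarter: "q * (1 - q) \<le> 1 / 4" for q :: real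
    using zero_le_power2[of "q - 1 / 2"] by (simp add: power2_eq_square algebra_simps)
  have margins: "(\<Sum>j\<in>J. \<alpha> j * of_bool (i \<in> A j)) \<le> 1 / 16" "(\<Sum>j\<in>J. \<alpha> j * of_bool (i \<in> B j)) \<le> 1 / 16"
    if i: "i \<in> {1..n}" for i
  proof -
    define q where "q = (\<Sum>S\<in>?F. w S * of_bool (i \<in> S))"
    have q': "(\<Sum>S\<in>?F. w' S * of_bool (i \<in> S)) = q" using w(5)[OF i] by (simp add: q_def)
    have nq: "(\<Sum>S\<in>?F. w S * of_bool (i \<notin> S)) = 1 - q" "(\<Sum>S\<in>?F. w' S * of_bool (i \<notin> S)) = 1 - q"
      using w(3,4) q' by (simp_all add: q_def of_bool_not_iff right_diff_distrib sum_subtractf)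
    define dA where "dA x = (of_bool (i \<in> fst x) * of_bool (i \<notin> snd x) :: real)" for x :: "nat set \<times> nat set"
    define dB where "dB x = (of_bool (i \<notin> fst x) * of_bool (i \<in> snd x) :: real)" for x :: "nat set \<times> nat set"
    have "(\<Sum>x\<in>X. \<beta> x * dA x) = q * (1 - q)"
      using prod_X[of "\<lambda>S. of_bool (i \<in> S)" "\<lambda>S. of_bool (i \<notin> S)"] nq by (simp add: dA_def q_def)
    moreover have "(\<Sum>x\<in>X. \<beta> x * dB x) = (1 - q) * q"
      using prod_X[of "\<lambda>S. of_bool (i \<notin> S)" "\<lambda>S. of_bool (i \<in> S)"] nq q' by (simp add: dB_def)
    moreover have "of_bool (i \<in> A j) = dA (fst j) * dA (snd j)" "of_bool (i \<in> B j) = dB (fst j) * dB (snd j)" for j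
      by (auto simp: A_def B_def dA_def dB_def)
    ultimately have "(\<Sum>j\<in>J. \<alpha> j * of_bool (i \<in> A j)) = (q * (1 - q))\<^sup>2"
      "(\<Sum>j\<in>J. \<alpha> j * of_bool (i \<in> B j)) = (q * (1 - q))\<^sup>2"
      using prod_J[of dA dA] prod_J[of dB dB] by (simp_all add: power2_eq_square mult_ac)
    moreover have "0 \<le> q" unfolding q_def using w(1) by (intro sum_nonneg) simp
    moreover have "0 \<le> 1 - q" unfolding nq(2)[symmetric] using w(2) by (intro sum_nonneg) simp
    ultimately have "(\<Sum>j\<in>J. \<alpha> j * of_bool (i \<in> A j)) = (q * (1 - q))\<^sup>2"
      "(\<Sum>j\<in>J. \<alpha> j * of_bool (i \<in> B j)) = (q * (1 - q))\<^sup>2" "0 \<le> q * (1 - q)"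
      by (simp_all only: mult_nonneg_nonneg)
    moreover from this(3) have "(q * (1 - q))\<^sup>2 \<le> (1 / 4)\<^sup>2" using quarter[of q] by (intro power_mono)
    ultimately show "(\<Sum>j\<in>J. \<alpha> j * of_bool (i \<in> A j)) \<le> 1 / 16" "(\<Sum>j\<in>J. \<alpha> j * of_bool (i \<in> B j)) \<le> 1 / 16"
      by (simp_all add: power2_eq_square)
  qed
  have AB: "A j \<subseteq> {1..n}" "B j \<subseteq> {1..n}" if "j \<in> J" for j
    using that by (auto simp: A_def B_def J_def X_def)
  have "(\<Sum>j\<in>J. \<alpha> j * (f (A j) - f {})) \<le> 5 * \<epsilon> + (M - f {}) / 4"
    using mod eps fin(2) AB(1) \<alpha>0 eq_refl[OF \<alpha>1] margins(1) abs_le_D1[OF M] by (rule weighted_average_le)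
  \<comment> \<open>Applied to \<open>- f\<close>, so that on adding the two bounds the terms in
    \<open>f {}\<close> cancel and \<open>M / 2\<close> remains.\<close>
  moreover have "(\<Sum>j\<in>J. \<alpha> j * (- f (B j) - - f {})) \<le> 5 * \<epsilon> + (M - - f {}) / 4"
    using modular_within_uminus[OF mod] eps fin(2) AB(2) \<alpha>0 eq_refl[OF \<alpha>1] margins(2) abs_le_D2[OF M]
    by (rule weighted_average_le)
  ultimately have "(\<Sum>j\<in>J. \<alpha> j * (f (A j) - f (B j))) \<le> 10 * \<epsilon> + M / 2"
    using \<alpha>1 by (simp add: right_diff_distrib sum_subtractf flip: sum_distrib_right) (simp add: field_simps)
  moreover have "(\<Sum>j\<in>J. \<alpha> j * (u (fst j) + u (snd j)) - \<alpha> j * (2 * M + 6 * \<epsilon>)) \<le> (\<Sum>j\<in>J. \<alpha> j * (f (A j) - f (B j)))"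
  proof (rule sum_mono)
    fix j assume j: "j \<in> J"
    \<comment> \<open>Both sets are split along their intersection, whose value cancels together
      with \<open>f {}\<close>; the two splittings cost 2 \<epsilon>.\<close>
    have diff: "u x - 2 * \<epsilon> \<le> f (fst x - snd x) - f (snd x - fst x)" if "x \<in> X" for x
    proof -
      have sub: "fst x \<subseteq> {1..n}" "snd x \<subseteq> {1..n}" using that by (auto simp: X_def)
      have "fst x - snd x \<union> fst x \<inter> snd x = fst x" "(fst x - snd x) \<inter> (fst x \<inter> snd x) = {}"
        "snd x - fst x \<union> fst x \<inter> snd x = snd x" "(snd x - fst x) \<inter> (fst x \<inter> snd x) = {}" by auto
      then show ?thesis
        using modular_withinD[OF mod, of "fst x - snd x" "fst x \<inter> snd x"]
          modular_withinD[OF mod, of "snd x - fst x" "fst x \<inter> snd x"] sub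
        by (simp add: u_def abs_le_iff subset_iff)
    qed
    have inter: "f S + f T - M - \<epsilon> \<le> f (S \<inter> T)" "f (S \<inter> T) \<le> f S + f T + M + \<epsilon>"
      if "S \<subseteq> {1..n}" "T \<subseteq> {1..n}" for S T
      using modular_withinD[OF mod that] M[of "S \<union> T"] that by (simp_all add: abs_le_iff)
    have x: "fst j \<in> X" "snd j \<in> X" using j by (auto simp: J_def)
    then have sub: "fst (fst j) - snd (fst j) \<subseteq> {1..n}" "fst (snd j) - snd (snd j) \<subseteq> {1..n}"
      "snd (fst j) - fst (fst j) \<subseteq> {1..n}" "snd (snd j) - fst (snd j) \<subseteq> {1..n}"
      by (auto simp: X_def)
    \<comment> \<open>Two uses of \<open>diff\<close> cost 4 \<epsilon>. Each use of
      \<open>inter\<close> costs \<epsilon>, and \<open>M\<close> for the value of the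
      union.\<close>
    have "u (fst j) + u (snd j) - (2 * M + 6 * \<epsilon>) \<le> f (A j) - f (B j)"
      using diff[OF x(1)] diff[OF x(2)] inter(1)[OF sub(1,2)] inter(2)[OF sub(3,4)]
      unfolding A_def B_def by linarith
    then show "\<alpha> j * (u (fst j) + u (snd j)) - \<alpha> j * (2 * M + 6 * \<epsilon>) \<le> \<alpha> j * (f (A j) - f (B j))"
      unfolding right_diff_distrib[symmetric] using \<alpha>0[OF j] by (intro mult_left_mono)
  qed
  moreover have "(\<Sum>j\<in>J. \<alpha> j * (u (fst j) + u (snd j)) - \<alpha> j * (2 * M + 6 * \<epsilon>))
    = 2 * (\<Sum>x\<in>X. \<beta> x * u x) - (2 * M + 6 * \<epsilon>)"
    unfolding sum_subtractf mean_uu sum_distrib_right[symmetric] \<alpha>1 by simp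
  ultimately show ?thesis unfolding mean_u by simp
qed

section \<open>Best approximation and the constant 32/3\<close>

lemma linear_within_mono: "linear_within n D f \<Longrightarrow> D \<le> D' \<Longrightarrow> linear_within n D' f"
  unfolding linear_within_def by (meson order_trans)

text \<open>The admissible errors are bounded below by 0, the zero function shows that there are
  some, and \<open>linear_within_closed\<close> makes the infimum one of them.\<close>

lemma exists_best_linear_approximation:
  obtains M where "linear_within n M f" "\<And>K. K < M \<Longrightarrow> \<not> linear_within n K f"
proof -
  define X where "X = {D. linear_within n D f}"
  have "linear_within n (\<Sum>S\<in>Pow {1..n}. \<bar>f S\<bar>) f"
    unfolding linear_within_def
  proof (intro exI[of _ "\<lambda>_. 0"] conjI allI impI)
    show "linear_set_function n (\<lambda>_. 0)"
      unfolding linear_set_function_def by (intro exI[of _ "\<lambda>_. 0"]) simp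
    show "\<bar>f S - 0\<bar> \<le> (\<Sum>S\<in>Pow {1..n}. \<bar>f S\<bar>)" if "S \<subseteq> {1..n}" for S
      using member_le_sum[of S "Pow {1..n}" "\<lambda>S. \<bar>f S\<bar>"] that by simp
  qed
  then have ne: "X \<noteq> {}" by (auto simp: X_def)
  have bdd: "bdd_below X"
  proof (rule bdd_belowI[of _ 0])
    fix D assume "D \<in> X"
    then obtain l where "\<bar>f {} - l {}\<bar> \<le> D" by (auto simp: X_def linear_within_def)
    then show "0 \<le> D" by linarith
  qed
  show thesis
  proof
    show "linear_within n (Inf X) f"
    proof (rule linear_within_closed)
      fix \<delta> :: real assume "0 < \<delta>"
      then obtain D where "D \<in> X" "D < Inf X + \<delta>"
        using cInf_lessD[OF ne, of "Inf X + \<delta>"] by auto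
      then show "linear_within n (Inf X + \<delta>) f"
        using linear_within_mono[of n D f] by (simp add: X_def)
    qed
    show "\<not> linear_within n K f" if "K < Inf X" for K
      using cInf_lower[OF _ bdd, of K] that by (auto simp: X_def)
  qed
qed

text \<open>For the best error \<open>M\<close>, duality gives a gap above \<open>2 * K\<close> for
  each \<open>K < M\<close>, while \<open>dual_gap_le\<close> bounds twice the gap by
  \<open>5 / 2 * M + 16 * \<epsilon>\<close>. Letting \<open>K\<close> tend to \<open>M\<close>
  leaves \<open>3 / 2 * M \<le> 16 * \<epsilon>\<close>.\<close>

theorem Kalton_bound_32_3: "Kalton_bound (32 / 3)"
  unfolding Kalton_bound_def
proof (intro allI impI)
  fix n \<epsilon> f assume eps: "0 \<le> \<epsilon>" and mod: "modular_within n \<epsilon> f"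
  obtain M where M: "linear_within n M f" "\<And>K. K < M \<Longrightarrow> \<not> linear_within n K f"
    using exists_best_linear_approximation[of n f] by blast
  then obtain l c where l: "\<And>S. S \<subseteq> {1..n} \<Longrightarrow> l S = c 0 + sum c S"
    "\<And>S. S \<subseteq> {1..n} \<Longrightarrow> \<bar>f S - l S\<bar> \<le> M"
    unfolding linear_within_def linear_set_function_def by blast
  define g where "g S = f S - l S" for S
  have g_mod: "modular_within n \<epsilon> g"
    unfolding modular_within_def
  proof (intro allI impI)
    fix S T assume ST: "S \<subseteq> {1..n}" "T \<subseteq> {1..n}"
    then have "sum c (S \<union> T) + sum c (S \<inter> T) = sum c S + sum c T"
      by (intro sum.union_inter) (auto intro: finite_subset)
    moreover have "S \<union> T \<subseteq> {1..n}" "S \<inter> T \<subseteq> {1..n}" using ST by auto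
    ultimately have "l (S \<union> T) + l (S \<inter> T) = l S + l T" using ST by (simp add: l(1))
    then have "g S + g T - g (S \<union> T) - g (S \<inter> T) = f S + f T - f (S \<union> T) - f (S \<inter> T)"
      by (simp add: g_def)
    then show "\<bar>g S + g T - g (S \<union> T) - g (S \<inter> T)\<bar> \<le> \<epsilon>"
      using modular_withinD[OF mod ST] by simp
  qed
  have "4 * K - 16 * \<epsilon> \<le> 5 / 2 * M" if K: "K < M" for K
  proof -
    \<comment> \<open>An approximation of \<open>g\<close> within \<open>K\<close>, added to
      \<open>l\<close>, would beat the best error \<open>M\<close>.\<close>
    have "\<not> linear_within n K g"
    proof
      assume "linear_within n K g"
      then obtain l' c' where l': "\<And>S. S \<subseteq> {1..n} \<Longrightarrow> l' S = c' 0 + sum c' S"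
        "\<And>S. S \<subseteq> {1..n} \<Longrightarrow> \<bar>g S - l' S\<bar> \<le> K"
        unfolding linear_within_def linear_set_function_def by blast
      have "linear_set_function n (\<lambda>S. l S + l' S)"
        unfolding linear_set_function_def
        by (intro exI[of _ "\<lambda>i. c i + c' i"]) (simp add: l l' sum.distrib)
      moreover have "\<bar>f S - (l S + l' S)\<bar> \<le> K" if "S \<subseteq> {1..n}" for S
        using l'(2)[OF that] by (simp add: g_def algebra_simps)
      ultimately have "linear_within n K f" unfolding linear_within_def by blast
      then show False using M(2)[OF K] by simp
    qed
    then obtain w w' where w: "\<And>S. S \<subseteq> {1..n} \<Longrightarrow> 0 \<le> w S" "\<And>S. S \<subseteq> {1..n} \<Longrightarrow> 0 \<le> w' S"
      "(\<Sum>S\<in>Pow {1..n}. w S) = 1" "(\<Sum>S\<in>Pow {1..n}. w' S) = 1"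
      "\<And>i. i \<in> {1..n} \<Longrightarrow>
        (\<Sum>S\<in>Pow {1..n}. w S * of_bool (i \<in> S)) = (\<Sum>S\<in>Pow {1..n}. w' S * of_bool (i \<in> S))"
      and gap: "2 * K < (\<Sum>S\<in>Pow {1..n}. w S * g S) - (\<Sum>S\<in>Pow {1..n}. w' S * g S)"
      by (rule not_linear_within_imp_dual_weights) blast
    have g_le: "\<bar>g S\<bar> \<le> M" if "S \<subseteq> {1..n}" for S using l(2)[OF that] by (simp add: g_def)
    have "2 * ((\<Sum>S\<in>Pow {1..n}. w S * g S) - (\<Sum>S\<in>Pow {1..n}. w' S * g S)) \<le> 5 / 2 * M + 16 * \<epsilon>"
      using g_mod eps g_le w by (rule dual_gap_le)
    moreover have "4 * K - 16 * \<epsilon> \<le> 5 / 2 * M" if "2 * K < d" "2 * d \<le> 5 / 2 * M + 16 * \<epsilon>" for d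
      using that by simp
    ultimately show ?thesis using gap by blast
  qed
  then have "K \<le> (5 / 2 * M + 16 * \<epsilon>) / 4" if "K < M" for K using that by fastforce
  then have "M \<le> (5 / 2 * M + 16 * \<epsilon>) / 4" by (rule dense_le)
  then have "M \<le> 32 / 3 * \<epsilon>" by simp
  with M(1) show "linear_within n (32 / 3 * \<epsilon>) f" by (rule linear_within_mono)
qed

theorem theorem1:
  "(\<exists>K :: real. K < 12.65 \<and>
      (\<forall>(n :: nat) (\<epsilon> :: real) (f :: nat set \<Rightarrow> real).
         2 \<le> n \<longrightarrow> 0 \<le> \<epsilon> \<longrightarrow> modular_within n \<epsilon> f \<longrightarrow> linear_within n (K * \<epsilon>) f)) \<and>
   strong_Kalton_constant < 12.65"
proof
  show "\<exists>K :: real. K < 12.65 \<and>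
      (\<forall>(n :: nat) (\<epsilon> :: real) (f :: nat set \<Rightarrow> real).
         2 \<le> n \<longrightarrow> 0 \<le> \<epsilon> \<longrightarrow> modular_within n \<epsilon> f \<longrightarrow> linear_within n (K * \<epsilon>) f)"
    using Kalton_bound_32_3 unfolding Kalton_bound_def by (intro exI[of _ "32 / 3"]) simp
  show "strong_Kalton_constant < 12.65"
    using strong_Kalton_is_least(2)[OF Kalton_bound_32_3] by simp
qed

end
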